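(* Let $L$ be a finite-dimensional upper semi-modular solvable Leibniz algebra over an arbitrary field $F$, and let $J=\langle x\in L\mid x^2=0\rangle$ be the subalgebra of $L$ generated by all elements with square zero. If $J$ is an almost abelian Leibniz algebra (of either the Lie or the non-Lie type), then $L=J$.
   Context: A (right) Leibniz algebra over a field $F$ is a vector space $L$ with a bilinear product $[\cdot,\cdot]$ satisfying $[x,[y,z]]=[[x,y],z]-[[x,z],y]$ for all $x,y,z$. Write $x^2=[x,x]$. $L$ is solvable if $L^{(n)}=0$ for some $n$, where $L^{(0)}=L$, $L^{(k+1)}=[L^{(k)},L^{(k)}]$. A Leibniz algebra is abelian if all its products are zero. For subalgebras (or elements) $U,B$, $\langle U,B\rangle$ denotes the subalgebra they generate. A subalgebra $U$ of $L$ is upper semi-modular in $L$ if $U$ is a maximal subalgebra of $\langle U,B\rangle$ for every subalgebra $B$ of $L$ such that $U\cap B$ is a maximal subalgebra of $B$ (a maximal subalgebra is a maximal proper subalgebra). $L$ is upper semi-modular if every subalgebra of $L$ is upper semi-modular in $L$. A Leibniz algebra $M$ is almost abelian if $M=A+Fy$ where $A\neq 0$ is an abelian ideal, $[a,y]=a$ for all $a\in A$, and either $[y,a]=-a$ for all $a\in A$ (almost abelian Lie algebra; here $M$ is a Lie algebra), or $[y,a]=0$ for all $a\in A$ (almost abelian non-Lie Leibniz algebra); $y$ may be taken with $y^2=0$. *)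

theory Defs
  imports Complex_Main "HOL.Hull"
begin

text \<open>The algebra is the whole type \<^typ>\<open>'v\<close>; its subalgebras are sets.
  Leibniz algebras are right Leibniz algebras: right multiplications are derivations.\<close>

locale leibniz_algebra = vector_space scale
  for scale :: "'f::field \<Rightarrow> 'v::ab_group_add \<Rightarrow> 'v" (infixr "*s" 75) +
  fixes br :: "'v \<Rightarrow> 'v \<Rightarrow> 'v"
  assumes linear_left: "Vector_Spaces.linear scale scale (\<lambda>x. br x y)"
    and linear_right: "Vector_Spaces.linear scale scale (br x)"
    and leibniz: "br x (br y z) = br (br x y) z - br (br x z) y"
begin

definition product_space :: "'v set \<Rightarrow> 'v set \<Rightarrow> 'v set" where
  "product_space A B = span {br a b | a b. a \<in> A \<and> b \<in> B}"

primrec derived_series :: "nat \<Rightarrow> 'v set" where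
  "derived_series 0 = UNIV"
| "derived_series (Suc k) = product_space (derived_series k) (derived_series k)"

definition solvable :: bool where
  "solvable \<longleftrightarrow> (\<exists>n. derived_series n = {0})"

definition subalgebra :: "'v set \<Rightarrow> bool" where
  "subalgebra S \<longleftrightarrow> subspace S \<and> (\<forall>x\<in>S. \<forall>y\<in>S. br x y \<in> S)"

definition generated :: "'v set \<Rightarrow> 'v set" where
  "generated X = subalgebra hull X"

definition maximal_subalgebra :: "'v set \<Rightarrow> 'v set \<Rightarrow> bool" where
  "maximal_subalgebra M B \<longleftrightarrow> subalgebra M \<and> subalgebra B \<and> M \<subset> B \<and>
     (\<forall>S. subalgebra S \<and> M \<subseteq> S \<and> S \<subseteq> B \<longrightarrow> S = M \<or> S = B)"

definition upper_semi_modular_in :: "'v set \<Rightarrow> bool" where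
  "upper_semi_modular_in U \<longleftrightarrow> subalgebra U \<and>
     (\<forall>B. subalgebra B \<and> maximal_subalgebra (U \<inter> B) B
        \<longrightarrow> maximal_subalgebra U (generated (U \<union> B)))"

definition upper_semi_modular :: bool where
  "upper_semi_modular \<longleftrightarrow> (\<forall>U. subalgebra U \<longrightarrow> upper_semi_modular_in U)"

definition ideal_of :: "'v set \<Rightarrow> 'v set \<Rightarrow> bool" where
  "ideal_of A M \<longleftrightarrow> subspace A \<and> A \<subseteq> M \<and> (\<forall>a\<in>A. \<forall>m\<in>M. br a m \<in> A \<and> br m a \<in> A)"

definition abelian :: "'v set \<Rightarrow> bool" where
  "abelian A \<longleftrightarrow> (\<forall>x\<in>A. \<forall>y\<in>A. br x y = 0)"

text \<open>\<open>M = A + Fy\<close> with \<open>[a, y] = a\<close> on the nonzero abelian ideal \<open>A\<close>. No condition on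
  \<open>[y, y]\<close> is imposed: in the Lie type below it vanishes (and \<open>M\<close> is a Lie algebra), and in
  the non-Lie type \<open>y\<close> can be changed by an element of \<open>A\<close> so that it vanishes; see
  \<open>almost_abelian_lie_square\<close> and \<open>almost_abelian_nonlie_square\<close>.\<close>

definition almost_abelian_split :: "'v set \<Rightarrow> 'v set \<Rightarrow> 'v \<Rightarrow> bool" where
  "almost_abelian_split M A y \<longleftrightarrow> subalgebra M \<and> ideal_of A M \<and> abelian A \<and> A \<noteq> {0} \<and>
     M = {a + c *s y | a c. a \<in> A} \<and> (\<forall>a\<in>A. br a y = a)"

definition almost_abelian_lie :: "'v set \<Rightarrow> bool" where
  "almost_abelian_lie M \<longleftrightarrow>
     (\<exists>A y. almost_abelian_split M A y \<and> (\<forall>a\<in>A. br y a = - a))"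

definition almost_abelian_nonlie :: "'v set \<Rightarrow> bool" where
  "almost_abelian_nonlie M \<longleftrightarrow>
     (\<exists>A y. almost_abelian_split M A y \<and> (\<forall>a\<in>A. br y a = 0))"

definition almost_abelian :: "'v set \<Rightarrow> bool" where
  "almost_abelian M \<longleftrightarrow> almost_abelian_lie M \<or> almost_abelian_nonlie M"

lemmas br_add_left = module_hom.add[OF linear_left[unfolded linear_iff_module_hom]]
lemmas br_add_right = module_hom.add[OF linear_right[unfolded linear_iff_module_hom]]
lemmas br_scale_left = module_hom.scale[OF linear_left[unfolded linear_iff_module_hom]]
lemmas br_scale_right = module_hom.scale[OF linear_right[unfolded linear_iff_module_hom]]
lemmas br_diff_left = module_hom.diff[OF linear_left[unfolded linear_iff_module_hom]]
lemmas br_diff_right = module_hom.diff[OF linear_right[unfolded linear_iff_module_hom]]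

lemma almost_abelian_splitD:
  assumes "almost_abelian_split M A y"
  shows "subspace A" and "\<And>x z. x \<in> M \<Longrightarrow> z \<in> M \<Longrightarrow> br x z \<in> M"
    and "\<And>x z. x \<in> A \<Longrightarrow> z \<in> A \<Longrightarrow> br x z = 0"
    and "A \<noteq> {0}" and "M = {a + c *s y | a c. a \<in> A}" and "\<And>a. a \<in> A \<Longrightarrow> br a y = a"
  using assms
  unfolding almost_abelian_split_def ideal_of_def abelian_def subalgebra_def by blast+

lemma almost_abelian_split_square_in:
  assumes "almost_abelian_split M A y"
  shows "br y y \<in> A"
proof -
  note D = almost_abelian_splitD[OF assms]
  have A0: "0 \<in> A" using D(1) by (rule subspace_0)
  have "y = 0 + 1 *s y" by simp
  then have "y \<in> M" unfolding D(5) using A0 by blast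
  then have "br y y \<in> M" using D(2) by blast
  then obtain a0 c where yy: "br y y = a0 + c *s y" "a0 \<in> A" unfolding D(5) by blast
  obtain a where a: "a \<in> A" "a \<noteq> 0" using D(4) A0 by blast
  have "br a (br y y) = 0" using leibniz[of a y y] by simp
  moreover have "br a (br y y) = br a a0 + c *s br a y"
    unfolding yy(1) br_add_right br_scale_right ..
  ultimately have "c *s a = 0" using D(3)[OF a(1) yy(2)] D(6)[OF a(1)] by simp
  then have "c = 0" using a(2) by simp
  then show ?thesis using yy by simp
qed

lemma almost_abelian_lie_square:
  assumes "almost_abelian_split M A y" "\<forall>a\<in>A. br y a = - a"
  shows "br y y = 0" and "\<And>x. x \<in> M \<Longrightarrow> br x x = 0"
proof -
  note D = almost_abelian_splitD[OF assms(1)]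
  have "br y (br y y) = 0" using leibniz[of y y y] by simp
  moreover have "br y (br y y) = - br y y"
    using almost_abelian_split_square_in[OF assms(1)] assms(2) by blast
  ultimately show yy: "br y y = 0" by simp
  fix x assume "x \<in> M"
  then obtain a c where x: "x = a + c *s y" and a: "a \<in> A" unfolding D(5) by blast
  have "br y a = - a" using a assms(2) by blast
  then show "br x x = 0"
    unfolding x by (simp add: br_add_left br_add_right br_scale_left br_scale_right
      yy D(3)[OF a a] D(6)[OF a])
qed

lemma almost_abelian_nonlie_square:
  assumes "almost_abelian_split M A y" "\<forall>a\<in>A. br y a = 0"
  shows "\<exists>z. almost_abelian_split M A z \<and> (\<forall>a\<in>A. br z a = 0) \<and> br z z = 0"
proof -
  note D = almost_abelian_splitD[OF assms(1)]
  define b where "b = br y y"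
  have b: "b \<in> A" unfolding b_def using almost_abelian_split_square_in[OF assms(1)] .
  have yb: "br y b = 0" using b assms(2) by blast
  have "{a + c *s y | a c. a \<in> A} = {a + c *s (y - b) | a c. a \<in> A}" (is "?P = ?Q")
  proof (intro equalityI subsetI)
    fix x assume "x \<in> ?P"
    then obtain a c where x: "x = a + c *s y" "a \<in> A" by blast
    then have "x = (a + c *s b) + c *s (y - b)" by (simp add: scale_right_diff_distrib)
    moreover have "a + c *s b \<in> A" using x b D(1) by (simp add: subspace_add subspace_scale)
    ultimately show "x \<in> ?Q" by blast
  next
    fix x assume "x \<in> ?Q"
    then obtain a c where x: "x = a + c *s (y - b)" "a \<in> A" by blast
    then have "x = (a - c *s b) + c *s y" by (simp add: scale_right_diff_distrib)
    moreover have "a - c *s b \<in> A" using x b D(1) by (simp add: subspace_diff subspace_scale)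
    ultimately show "x \<in> ?P" by blast
  qed
  then have M: "M = ?Q" using D(5) by (rule trans[rotated])
  have "br a (y - b) = a" if "a \<in> A" for a
    using D(3)[OF that b] D(6)[OF that] by (simp add: br_diff_right)
  then have "almost_abelian_split M A (y - b)"
    using M assms(1) unfolding almost_abelian_split_def by blast
  moreover have "br (y - b) a = 0" if "a \<in> A" for a
    using D(3)[OF b that] assms(2) that by (simp add: br_diff_left)
  moreover have "br (y - b) (y - b) = 0"
    using yb D(3)[OF b b] D(6)[OF b] b_def[symmetric] by (simp add: br_diff_left br_diff_right)
  ultimately show ?thesis by blast
qed

end

end

theory Submission
  imports Defs
begin

text \<open>Squares annihilate \<open>L\<close> from the right, so they have square zero and lie in
  \<open>J = A + Fy\<close>; since \<open>y\<close> acts on \<open>A\<close> as the identity, they even lie in \<open>A\<close>. If \<open>J\<close> is of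
  Lie type, a square \<open>s\<close> then satisfies \<open>s = - [y, s] = 0\<close>. If \<open>J\<close> is of non-Lie type, take
  \<open>y\<^sup>2 = 0\<close>; then \<open>a = (a + y)\<^sup>2\<close> on \<open>A\<close>, so \<open>[L, A] = 0\<close> and \<open>[A, L] \<subseteq> A\<close>. For any \<open>z\<close> the element
  \<open>w = [z, y]\<close> acts trivially on \<open>A\<close>, because \<open>y\<close> acts as a scalar. Hence \<open>w + y + a\<close> has square
  zero for \<open>a = - (w + y)\<^sup>2\<close>, which puts \<open>w\<close> in \<open>J\<close> and, again by its trivial action, in \<open>A\<close>. Now
  \<open>0 = [z, [z, y]] = z\<^sup>2 - [w, z]\<close>, that is, \<open>(z - w)\<^sup>2 = 0\<close>, and so \<open>z \<in> J\<close>.\<close>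

context leibniz_algebra
begin

lemma br_square_right: "br x (br z z) = 0"
  using leibniz[of x z z] by simp

lemma generated_superset: "X \<subseteq> generated X"
  unfolding generated_def by (rule hull_subset)

lemma almost_abelian_split_mem:
  assumes "almost_abelian_split M A y"
  shows "y \<in> M" and "A \<subseteq> M"
proof -
  note D = almost_abelian_splitD[OF assms]
  have "y = 0 + 1 *s y" by simp
  then show "y \<in> M" unfolding D(5) using subspace_0[OF D(1)] by blast
  have "a = a + 0 *s y" for a by simp
  then show "A \<subseteq> M" unfolding D(5) by blast
qed

text \<open>If \<open>s = a0 + c *s y\<close>, then \<open>br a s = c *s a\<close> on
  \<open>A\<close>; one nonzero \<open>a\<close> forces \<open>c = 0\<close>.\<close>

lemma almost_abelian_split_annihilator:
  assumes "almost_abelian_split M A y" "s \<in> M" "\<And>a. a \<in> A \<Longrightarrow> br a s = 0"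
  shows "s \<in> A"
proof -
  note D = almost_abelian_splitD[OF assms(1)]
  obtain a0 c where s: "s = a0 + c *s y" "a0 \<in> A" using assms(2) D(5) by blast
  obtain a where a: "a \<in> A" "a \<noteq> 0" using D(4) subspace_0[OF D(1)] by blast
  have "c *s a = br a s"
    unfolding s(1) br_add_right br_scale_right using D(3)[OF a(1) s(2)] D(6)[OF a(1)] by simp
  then have "c = 0" using assms(3)[OF a(1)] a(2) by simp
  then show ?thesis using s by simp
qed

lemma square_in_almost_abelian_split:
  assumes "almost_abelian_split M A y" "{x. br x x = 0} \<subseteq> M"
  shows "br x x \<in> A"
  using assms(2) br_square_right
  by (intro almost_abelian_split_annihilator[OF assms(1)]) auto

lemma UNIV_if_almost_abelian_lie:
  assumes "almost_abelian_lie M" "{x. br x x = 0} \<subseteq> M"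
  shows "M = UNIV"
proof -
  obtain A y where split: "almost_abelian_split M A y" and y: "\<forall>a\<in>A. br y a = - a"
    using assms(1) unfolding almost_abelian_lie_def by blast
  have "br x x = 0" for x
  proof -
    have "br y (br x x) = - br x x"
      using y square_in_almost_abelian_split[OF split assms(2)] by blast
    then show ?thesis by (simp add: br_square_right)
  qed
  then show ?thesis using assms(2) by blast
qed

lemma UNIV_if_almost_abelian_nonlie:
  assumes "almost_abelian_nonlie M" "{x. br x x = 0} \<subseteq> M"
  shows "M = UNIV"
proof -
  obtain A y where split: "almost_abelian_split M A y" and yA: "\<And>a. a \<in> A \<Longrightarrow> br y a = 0"
    and yy: "br y y = 0"
    using assms(1) almost_abelian_nonlie_square unfolding almost_abelian_nonlie_def by metis
  note D = almost_abelian_splitD[OF split]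
  note square = square_in_almost_abelian_split[OF split assms(2)]
  have M: "subspace M" using split unfolding almost_abelian_split_def subalgebra_def by blast
  have a_square: "a = br (a + y) (a + y)" if "a \<in> A" for a
    by (simp add: br_add_left br_add_right D(3,6) yA yy that)
  have right_annih: "br x a = 0" if "a \<in> A" for x a
    using a_square[OF that] br_square_right by metis
  have right_mult: "br a x \<in> A" if "a \<in> A" for x a
  proof -
    \<comment> \<open>Polarisation: both squares lie in \<open>A\<close>, while
      \<open>br x a\<close> and \<open>br a a\<close> vanish.\<close>
    have "br a x = br (a + x) (a + x) - br x x"
      by (simp add: br_add_left br_add_right right_annih that)
    then show ?thesis using square D(1) by (simp add: subspace_diff)
  qed
  have "z \<in> M" for z
  proof -
    define w where "w = br z y"
    \<comment> \<open>The Leibniz identity leaves \<open>br (br a z) y - br (br a y) z\<close>; both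
      terms equal \<open>br a z\<close>, which lies in \<open>A\<close>.\<close>
    have Aw: "br a w = 0" if "a \<in> A" for a
      using leibniz[of a z y] that right_mult D(6) unfolding w_def by simp
    define a where "a = - br (w + y) (w + y)"
    have a: "a \<in> A" unfolding a_def using square D(1) by (simp add: subspace_neg)
    have "br (w + y + a) (w + y + a) = br (w + y) (w + y) + br a (w + y)"
      using a right_annih by (simp add: br_add_left[of _ a] br_add_right[of _ _ a])
    also have "br a (w + y) = a" using a by (simp add: br_add_right Aw D(6))
    finally have "br (w + y + a) (w + y + a) = 0" unfolding a_def by simp
    then have "w + y + a \<in> M" using assms(2) by blast
    moreover have "y + a \<in> M"
      using almost_abelian_split_mem[OF split] a M by (blast intro: subspace_add)
    ultimately have "(w + y + a) - (y + a) \<in> M" using M by (rule subspace_diff[rotated])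
    then have wM: "w \<in> M" by (simp add: algebra_simps)
    then have wA: "w \<in> A" using Aw by (rule almost_abelian_split_annihilator[OF split])
    \<comment> \<open>Here \<open>br z w = 0\<close> since \<open>w\<close> is in \<open>A\<close>,
      and right multiplication by \<open>y\<close> fixes the square \<open>br z z\<close>.\<close>
    have "br z z = br w z"
      using leibniz[of z z y] right_annih[OF wA] D(6)[OF square] unfolding w_def by simp
    then have "br (z - w) (z - w) = 0"
      by (simp add: br_diff_left br_diff_right right_annih wA)
    then have "z - w \<in> M" using assms(2) by blast
    then have "(z - w) + w \<in> M" using M wM by (blast intro: subspace_add)
    then show ?thesis by simp
  qed
  then show ?thesis by blast
qed

end

theorem theorem2p8:
  fixes scale :: "'f::field \<Rightarrow> 'v::ab_group_add \<Rightarrow> 'v"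
    and br :: "'v \<Rightarrow> 'v \<Rightarrow> 'v"
    and J :: "'v set"
  assumes "leibniz_algebra scale br"
    and "\<exists>Basis. finite_dimensional_vector_space scale Basis"
    and "leibniz_algebra.upper_semi_modular scale br"
    and "leibniz_algebra.solvable scale br"
    and "J = leibniz_algebra.generated scale br {x. br x x = 0}"
    and "leibniz_algebra.almost_abelian scale br J"
  shows "J = UNIV"
proof -
  interpret leibniz_algebra scale br by (fact assms(1))
  have "{x. br x x = 0} \<subseteq> J" unfolding assms(5) by (rule generated_superset)
  then show ?thesis
    using assms(6) UNIV_if_almost_abelian_lie UNIV_if_almost_abelian_nonlie
    unfolding almost_abelian_def by blast
qed

end
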